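(* Let $R$ be a commutative reduced ring with unity. The following statements are equivalent. (a) The zero ideal of $R$ is an anti fixed-place ideal. (b) $\mathbb{AG}(R)$ is triangulated. (c) The space $\mathrm{Min}(R)$ does not have any isolated point.
   Context: For $S\subseteq R$, $\mathrm{Ann}(S)=\{x\in R: Sx=\{0\}\}$. $\mathbb{A}(R)^*$ is the set of non-zero ideals $I$ of $R$ with $\mathrm{Ann}(I)\neq\{0\}$; the annihilating-ideal graph $\mathbb{AG}(R)$ has vertex set $\mathbb{A}(R)^*$, distinct $I,J$ being adjacent iff $IJ=\{0\}$. A graph is triangulated if each of its vertices is a vertex of some triangle. $\mathrm{Min}(R)$ is the set of minimal prime ideals of $R$ with the Zariski topology (closed sets $\{P\in \mathrm{Min}(R): I\subseteq P\}$, $I$ an ideal of $R$). $\mathcal{B}(R)$ is the set of prime ideals $P$ of $R$ with $P=\mathrm{Ann}(x)$ for some $x\in R$ (Bourbaki associated prime divisors of the zero ideal). The zero ideal is anti fixed-place if $\mathcal{B}(R)=\emptyset$.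
   Formalization: The equivalence of (b) with (a) and (c) is stated only for rings that are not integral domains: for a domain AG(R) has no vertices, so (b) holds vacuously while (a) and (c) fail. The equivalence of (a) and (c) is stated for every reduced ring. *)

theory Defs
  imports "HOL-Algebra.Ideal_Product" "HOL-Analysis.Abstract_Topology"
begin

definition reduced_ring :: "('a, 'b) ring_scheme \<Rightarrow> bool" where
  "reduced_ring R \<longleftrightarrow>
     (\<forall>x\<in>carrier R. \<forall>n::nat. x [^]\<^bsub>R\<^esub> n = \<zero>\<^bsub>R\<^esub> \<longrightarrow> x = \<zero>\<^bsub>R\<^esub>)"

definition Ann :: "('a, 'b) ring_scheme \<Rightarrow> 'a set \<Rightarrow> 'a set" where
  "Ann R S = {x \<in> carrier R. \<forall>s\<in>S. s \<otimes>\<^bsub>R\<^esub> x = \<zero>\<^bsub>R\<^esub>}"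

definition bourbaki_primes :: "('a, 'b) ring_scheme \<Rightarrow> 'a set set" where
  "bourbaki_primes R = {P. primeideal P R \<and> (\<exists>x\<in>carrier R. P = Ann R {x})}"

definition zero_ideal_anti_fixed_place :: "('a, 'b) ring_scheme \<Rightarrow> bool" where
  "zero_ideal_anti_fixed_place R \<longleftrightarrow> bourbaki_primes R = {}"

text \<open>A graph is given by its vertex set and its adjacency relation. The three vertices of a
  triangle are required to be distinct. A graph without vertices is triangulated.\<close>

definition triangulated :: "'v set \<Rightarrow> ('v \<Rightarrow> 'v \<Rightarrow> bool) \<Rightarrow> bool" where
  "triangulated V adj \<longleftrightarrow>
     (\<forall>u\<in>V. \<exists>v\<in>V. \<exists>w\<in>V. u \<noteq> v \<and> u \<noteq> w \<and> v \<noteq> w \<and> adj u v \<and> adj u w \<and> adj v w)"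

definition AG_verts :: "('a, 'b) ring_scheme \<Rightarrow> 'a set set" where
  "AG_verts R = {I. ideal I R \<and> I \<noteq> {\<zero>\<^bsub>R\<^esub>} \<and> Ann R I \<noteq> {\<zero>\<^bsub>R\<^esub>}}"

definition AG_adj :: "('a, 'b) ring_scheme \<Rightarrow> 'a set \<Rightarrow> 'a set \<Rightarrow> bool" where
  "AG_adj R I J \<longleftrightarrow> I \<noteq> J \<and> ideal_prod R I J = {\<zero>\<^bsub>R\<^esub>}"

definition min_primes :: "('a, 'b) ring_scheme \<Rightarrow> 'a set set" where
  "min_primes R = {P. primeideal P R \<and> (\<forall>Q. primeideal Q R \<and> Q \<subseteq> P \<longrightarrow> Q = P)}"

text \<open>The open sets are the complements of the Zariski closed sets; the lemma
  \<open>openin_min_spec\<close> below shows that for commutative rings they do form a topology.\<close>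

definition min_spec :: "('a, 'b) ring_scheme \<Rightarrow> 'a set topology" where
  "min_spec R =
     topology (\<lambda>U. \<exists>I. ideal I R \<and> U = min_primes R - {P \<in> min_primes R. I \<subseteq> P})"

definition isolated_point :: "'a topology \<Rightarrow> 'a \<Rightarrow> bool" where
  "isolated_point X x \<longleftrightarrow> x \<in> topspace X \<and> openin X {x}"

lemma (in cring) istopology_min_spec:
  "istopology (\<lambda>U. \<exists>I. ideal I R \<and> U = min_primes R - {P \<in> min_primes R. I \<subseteq> P})"
  unfolding istopology_def
proof (intro conjI allI impI)
  fix S T
  assume "\<exists>I. ideal I R \<and> S = min_primes R - {P \<in> min_primes R. I \<subseteq> P}"
    and "\<exists>I. ideal I R \<and> T = min_primes R - {P \<in> min_primes R. I \<subseteq> P}"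
  then obtain I J where I: "ideal I R" "S = min_primes R - {P \<in> min_primes R. I \<subseteq> P}"
    and J: "ideal J R" "T = min_primes R - {P \<in> min_primes R. J \<subseteq> P}"
    by blast
  have *: "I \<inter> J \<subseteq> P \<longleftrightarrow> I \<subseteq> P \<or> J \<subseteq> P" if "P \<in> min_primes R" for P
  proof
    assume IJ: "I \<inter> J \<subseteq> P"
    have P: "primeideal P R" using that by (simp add: min_primes_def)
    show "I \<subseteq> P \<or> J \<subseteq> P"
    proof (rule ccontr)
      assume "\<not> ?thesis"
      then obtain a b where ab: "a \<in> I" "a \<notin> P" "b \<in> J" "b \<notin> P" by blast
      then have c: "a \<in> carrier R" "b \<in> carrier R"
        using ideal.Icarr[OF I(1)] ideal.Icarr[OF J(1)] by blast+
      then have "a \<otimes> b \<in> I \<inter> J"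
        using ideal.I_r_closed[OF I(1) ab(1)] ideal.I_l_closed[OF J(1) ab(3)] by blast
      then have "a \<in> P \<or> b \<in> P"
        using IJ primeideal.I_prime[OF P c] by blast
      with ab show False by blast
    qed
  qed blast
  have "S \<inter> T = min_primes R - {P \<in> min_primes R. I \<inter> J \<subseteq> P}"
    using I(2) J(2) * by blast
  then show "\<exists>I. ideal I R \<and> S \<inter> T = min_primes R - {P \<in> min_primes R. I \<subseteq> P}"
    using i_intersect[OF I(1) J(1)] by blast
next
  fix K
  assume "\<forall>S\<in>K. \<exists>I. ideal I R \<and> S = min_primes R - {P \<in> min_primes R. I \<subseteq> P}"
  then obtain f where
    f: "\<And>S. S \<in> K \<Longrightarrow> ideal (f S) R \<and> S = min_primes R - {P \<in> min_primes R. f S \<subseteq> P}"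
    by metis
  define G where "G = Idl (\<Union>S\<in>K. f S)"
  have sub: "(\<Union>S\<in>K. f S) \<subseteq> carrier R"
    using f by (meson UN_least ideal.Icarr subsetI)
  have G: "G \<subseteq> P \<longleftrightarrow> (\<forall>S\<in>K. f S \<subseteq> P)" if "P \<in> min_primes R" for P
  proof -
    have "ideal P R"
      using that by (simp add: min_primes_def primeideal.axioms(1))
    then show ?thesis
      unfolding G_def using Idl_subset_ideal[OF _ sub] by blast
  qed
  have mem: "P \<in> S \<longleftrightarrow> P \<in> min_primes R \<and> \<not> f S \<subseteq> P" if "S \<in> K" for P S
    by (subst conjunct2[OF f[OF that]]) blast
  have "\<Union>K = min_primes R - {P \<in> min_primes R. G \<subseteq> P}"
  proof (rule Set.set_eqI)
    fix P
    have "P \<in> \<Union>K \<longleftrightarrow> P \<in> min_primes R \<and> (\<exists>S\<in>K. \<not> f S \<subseteq> P)"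
      using mem by auto
    also have "\<dots> \<longleftrightarrow> P \<in> min_primes R - {P \<in> min_primes R. G \<subseteq> P}"
      using G by auto
    finally show "P \<in> \<Union>K \<longleftrightarrow> P \<in> min_primes R - {P \<in> min_primes R. G \<subseteq> P}" .
  qed
  moreover have "ideal G R"
    unfolding G_def by (rule genideal_ideal[OF sub])
  ultimately show "\<exists>I. ideal I R \<and> \<Union>K = min_primes R - {P \<in> min_primes R. I \<subseteq> P}"
    by blast
qed

lemma (in cring) openin_min_spec:
  "openin (min_spec R) U \<longleftrightarrow>
     (\<exists>I. ideal I R \<and> U = min_primes R - {P \<in> min_primes R. I \<subseteq> P})"
  unfolding min_spec_def by (simp add: topology_inverse'[OF istopology_min_spec])

lemma (in cring) topspace_min_spec: "topspace (min_spec R) = min_primes R"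
proof -
  have "\<not> carrier R \<subseteq> P" if "P \<in> min_primes R" for P
  proof
    assume "carrier R \<subseteq> P"
    moreover have P: "primeideal P R"
      using that by (simp add: min_primes_def)
    moreover have "P \<subseteq> carrier R"
      using ideal.Icarr[OF primeideal.axioms(1)[OF P]] by blast
    ultimately show False
      using primeideal.I_notcarr by blast
  qed
  then have "openin (min_spec R) (min_primes R)"
    unfolding openin_min_spec using oneideal by blast
  moreover have "U \<subseteq> min_primes R" if "openin (min_spec R) U" for U
    using that unfolding openin_min_spec by blast
  ultimately show ?thesis
    by (simp add: openin_subset subset_antisym)
qed

end

theory Submission
  imports Defs
begin

text \<open>
  In a reduced ring, a nonzero annihilator \<open>Ann(y)\<close> that is not prime yields \<open>a\<close>, \<open>b\<close> with
  \<open>ay\<close>, \<open>by\<close> nonzero and \<open>aby = 0\<close>; the principal ideals \<open>(ay)\<close>, \<open>(by)\<close> form a triangle with every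
  ideal killed by \<open>y\<close>. Conversely, a prime \<open>P = Ann(x)\<close>, if nonzero, lies in no triangle: one of the
  other two vertices would be contained in \<open>P\<close> and hence square to zero. Such a \<open>P\<close> is moreover the
  only minimal prime avoiding \<open>x\<close>, so it is isolated; an isolated \<open>P\<close> is cut out by some \<open>x\<close>,
  and then \<open>P = Ann(x)\<close>, because the minimal primes of a reduced ring intersect in zero.
\<close>

context cring
begin

section \<open>Annihilators, zero products of ideals and reducedness\<close>

lemma ideal_Ann: "x \<in> carrier R \<Longrightarrow> ideal (Ann R {x}) R"
proof (rule idealI)
  assume x: "x \<in> carrier R"
  show "ring R" by (rule ring_axioms)
  show "subgroup (Ann R {x}) (add_monoid R)"
    by (rule add.subgroupI)
       (use x in \<open>auto simp: Ann_def r_distr r_minus\<close>)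
next
  fix a r assume "x \<in> carrier R" and "a \<in> Ann R {x}" "r \<in> carrier R"
  then have *: "a \<in> carrier R" "x \<otimes> a = \<zero>" "x \<in> carrier R" "r \<in> carrier R"
    by (auto simp: Ann_def)
  then show "a \<otimes> r \<in> Ann R {x}" by (simp add: Ann_def flip: m_assoc)
  with * show "r \<otimes> a \<in> Ann R {x}" by (simp add: m_comm)
qed

text \<open>The product ideal consists of finite sums of elementwise products, so adjacency in the
  graph can be tested on elements.\<close>

lemma ideal_prod_eq_zero_iff:
  assumes "ideal I R" "ideal J R"
  shows "ideal_prod R I J = {\<zero>} \<longleftrightarrow> (\<forall>i\<in>I. \<forall>j\<in>J. i \<otimes> j = \<zero>)"
proof
  assume "ideal_prod R I J = {\<zero>}"
  then show "\<forall>i\<in>I. \<forall>j\<in>J. i \<otimes> j = \<zero>"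
    using ideal_prod.prod[of _ I _ J R] by (metis singletonD)
next
  assume *: "\<forall>i\<in>I. \<forall>j\<in>J. i \<otimes> j = \<zero>"
  have "s = \<zero>" if "s \<in> ideal_prod R I J" for s
    using that by (induction rule: ideal_prod.induct) (simp_all add: *)
  moreover have "\<zero> \<in> ideal_prod R I J"
    using ideal_prod.prod[of \<zero> I \<zero> J R] assms
    by (simp add: additive_subgroup.zero_closed ideal.axioms(1))
  ultimately show "ideal_prod R I J = {\<zero>}" by blast
qed

lemma reduced_square_zero:
  assumes "reduced_ring R" "x \<in> carrier R" "x \<otimes> x = \<zero>"
  shows "x = \<zero>"
proof -
  have "x [^] (2::nat) = \<zero>"
    using assms by (simp add: numeral_2_eq_2)
  then show ?thesis
    using assms unfolding reduced_ring_def by blast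
qed

lemma ideal_eq_zero_iff:
  assumes "ideal I R"
  shows "I = {\<zero>} \<longleftrightarrow> I \<subseteq> {\<zero>}"
  using assms by (auto simp: additive_subgroup.zero_closed ideal.axioms(1))

lemma reduced_ideal_square_zero:
  assumes "reduced_ring R" "ideal I R" "\<And>i j. i \<in> I \<Longrightarrow> j \<in> I \<Longrightarrow> i \<otimes> j = \<zero>"
  shows "I = {\<zero>}"
  unfolding ideal_eq_zero_iff[OF assms(2)]
  using reduced_square_zero[OF assms(1)] assms(3) ideal.Icarr[OF assms(2)] by blast

lemma primeideal_subset_or:
  assumes "primeideal P R" "ideal I R" "ideal J R" "\<And>i j. i \<in> I \<Longrightarrow> j \<in> J \<Longrightarrow> i \<otimes> j \<in> P"
  shows "I \<subseteq> P \<or> J \<subseteq> P"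
  using primeideal.I_prime[OF assms(1)] assms(4) ideal.Icarr[OF assms(2)] ideal.Icarr[OF assms(3)]
  by blast

lemma primeideal_zero_imp_domain:
  assumes "primeideal {\<zero>} R"
  shows "domain R"
proof unfold_locales
  show "\<one> \<noteq> \<zero>"
    using primeideal.I_notcarr[OF assms] carrier_one_zero by auto
  show "a = \<zero> \<or> b = \<zero>" if "a \<otimes> b = \<zero>" "a \<in> carrier R" "b \<in> carrier R" for a b
    using primeideal.I_prime[OF assms that(2,3)] that(1) by blast
qed

text \<open>As \<open>y\<close> is nonzero, \<open>Ann R {y}\<close> misses the unit and is proper.
  It can therefore fail to be prime only through two elements outside it whose product lies in
  it.\<close>

lemma nonprime_Ann_obtains:
  assumes "y \<in> carrier R" "y \<noteq> \<zero>" "\<not> primeideal (Ann R {y}) R"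
  obtains a b where "a \<in> carrier R" "b \<in> carrier R" "a \<otimes> b \<otimes> y = \<zero>" "a \<otimes> y \<noteq> \<zero>" "b \<otimes> y \<noteq> \<zero>"
proof -
  have "\<one> \<notin> Ann R {y}"
    using assms by (simp add: Ann_def)
  then have "carrier R \<noteq> Ann R {y}" by blast
  then obtain a b where "a \<in> carrier R" "b \<in> carrier R" "a \<otimes> b \<in> Ann R {y}"
      "a \<notin> Ann R {y}" "b \<notin> Ann R {y}"
    using assms primeidealI[OF ideal_Ann[OF assms(1)] is_cring] by blast
  with assms(1) show thesis
    by (intro that[of a b]) (auto simp: Ann_def m_comm)
qed

section \<open>Triangles in the annihilating-ideal graph\<close>

lemma PIdl_prod_eq_zero:
  assumes "a \<in> carrier R" "b \<in> carrier R" "a \<otimes> b = \<zero>" "i \<in> PIdl a" "j \<in> PIdl b"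
  shows "i \<otimes> j = \<zero>"
proof -
  from assms obtain r s where rs: "r \<in> carrier R" "i = r \<otimes> a" "s \<in> carrier R" "j = s \<otimes> b"
    by (auto simp: cgenideal_def)
  then have "i \<otimes> j = (r \<otimes> s) \<otimes> (a \<otimes> b)"
    using assms(1,2) by (simp add: m_ac)
  then show ?thesis
    using assms(3) rs by simp
qed

text \<open>Distinctness comes for free: if \<open>I = J\<close>, then \<open>I\<close> squares to
  zero, which forces \<open>I\<close> to be zero in a reduced ring.\<close>

lemma reduced_adj_if_prod_zero:
  assumes "reduced_ring R" "ideal I R" "ideal J R" "I \<noteq> {\<zero>}"
    and "\<And>i j. i \<in> I \<Longrightarrow> j \<in> J \<Longrightarrow> i \<otimes> j = \<zero>"
  shows "AG_adj R I J"
  unfolding AG_adj_def ideal_prod_eq_zero_iff[OF assms(2,3)]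
  using assms(5) reduced_ideal_square_zero[OF assms(1,2)] assms(4) by blast

lemma AG_vertsI:
  assumes "ideal I R" "I \<noteq> {\<zero>}" "y \<in> carrier R" "y \<noteq> \<zero>" "\<And>i. i \<in> I \<Longrightarrow> i \<otimes> y = \<zero>"
  shows "I \<in> AG_verts R"
proof -
  have "y \<in> Ann R I" using assms by (simp add: Ann_def)
  with assms show ?thesis by (auto simp: AG_verts_def)
qed

lemma triangulated_if_anti_fixed_place:
  assumes red: "reduced_ring R" and afp: "zero_ideal_anti_fixed_place R"
  shows "triangulated (AG_verts R) (AG_adj R)"
  unfolding triangulated_def
proof
  fix I assume "I \<in> AG_verts R"
  then have I: "ideal I R" "I \<noteq> {\<zero>}" "Ann R I \<noteq> {\<zero>}"
    by (auto simp: AG_verts_def)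
  have "\<zero> \<in> Ann R I"
    using ideal.Icarr[OF I(1)] by (simp add: Ann_def)
  with I(3) obtain y where y: "y \<in> carrier R" "y \<noteq> \<zero>" "\<And>i. i \<in> I \<Longrightarrow> i \<otimes> y = \<zero>"
    by (auto simp: Ann_def)
  have "\<not> primeideal (Ann R {y}) R"
    using afp y(1) by (auto simp: zero_ideal_anti_fixed_place_def bourbaki_primes_def)
  then obtain a b where ab: "a \<in> carrier R" "b \<in> carrier R" "a \<otimes> b \<otimes> y = \<zero>"
      "a \<otimes> y \<noteq> \<zero>" "b \<otimes> y \<noteq> \<zero>"
    using nonprime_Ann_obtains[OF y(1,2)] by blast
  let ?J = "PIdl (a \<otimes> y)" and ?K = "PIdl (b \<otimes> y)"
  have c: "a \<otimes> y \<in> carrier R" "b \<otimes> y \<in> carrier R"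
    using ab y by auto
  have J: "ideal ?J R" "?J \<noteq> {\<zero>}" and K: "ideal ?K R" "?K \<noteq> {\<zero>}"
    using cgenideal_ideal cgenideal_self c ab(4,5) by blast+
  \<comment> \<open>The regrouping isolates the factor a b y, which vanishes by the choice of
    \<open>a\<close> and \<open>b\<close>.\<close>
  have "(a \<otimes> y) \<otimes> (b \<otimes> y) = (a \<otimes> b \<otimes> y) \<otimes> y"
    using ab(1,2) y(1) by (simp add: m_ac)
  then have "(a \<otimes> y) \<otimes> (b \<otimes> y) = \<zero>"
    using ab(3) y(1) by simp
  then have JK: "j \<otimes> k = \<zero>" if "j \<in> ?J" "k \<in> ?K" for j k
    using PIdl_prod_eq_zero[OF c] that by blast
  \<comment> \<open>The multiplier \<open>t\<close> stands for both \<open>a\<close> and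
    \<open>b\<close>, so one computation makes \<open>I\<close> annihilate both principal
    ideals.\<close>
  have IP: "i \<otimes> j = \<zero>" if "i \<in> I" "j \<in> PIdl (t \<otimes> y)" "t \<in> carrier R" for i j t
  proof -
    have i: "i \<in> carrier R" using ideal.Icarr[OF I(1) that(1)] .
    have "i \<otimes> (t \<otimes> y) = t \<otimes> (i \<otimes> y)"
      using i that(3) y(1) by (simp add: m_ac)
    then have "i \<otimes> (t \<otimes> y) = \<zero>"
      using y(3)[OF that(1)] that(3) by simp
    then show ?thesis
      using PIdl_prod_eq_zero[OF i _ _ cgenideal_self[OF i] that(2)] that(3) y(1) by simp
  qed
  \<comment> \<open>Each of the two nonzero generators annihilates the ideal of the other and so
    witnesses that this ideal is a vertex.\<close>
  have vJ: "?J \<in> AG_verts R"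
    using AG_vertsI[OF J c(2) ab(5)] JK[OF _ cgenideal_self[OF c(2)]] by blast
  have vK: "?K \<in> AG_verts R"
  proof (rule AG_vertsI[OF K c(1) ab(4)])
    fix k assume k: "k \<in> ?K"
    show "k \<otimes> (a \<otimes> y) = \<zero>"
      using JK[OF cgenideal_self[OF c(1)] k] m_comm[OF ideal.Icarr[OF K(1) k] c(1)] by simp
  qed
  have "AG_adj R I ?J"
    using reduced_adj_if_prod_zero[OF red I(1) J(1) I(2)] IP[OF _ _ ab(1)] by simp
  moreover have "AG_adj R I ?K"
    using reduced_adj_if_prod_zero[OF red I(1) K(1) I(2)] IP[OF _ _ ab(2)] by simp
  moreover have "AG_adj R ?J ?K"
    using reduced_adj_if_prod_zero[OF red J(1) K(1) J(2)] JK by simp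
  ultimately
  show "\<exists>v\<in>AG_verts R. \<exists>w\<in>AG_verts R. I \<noteq> v \<and> I \<noteq> w \<and> v \<noteq> w \<and>
      AG_adj R I v \<and> AG_adj R I w \<and> AG_adj R v w"
    using vJ vK by (intro bexI[of _ ?J] bexI[of _ ?K]) (simp_all add: AG_adj_def)
qed

text \<open>A domain has to be excluded: its graph has no vertices and is vacuously triangulated,
  whereas its zero ideal is the prime Ann(1). Outside domains a prime \<open>Ann R {x}\<close> is
  nonzero, hence a vertex.\<close>

lemma anti_fixed_place_if_triangulated:
  assumes red: "reduced_ring R" and nd: "\<not> domain R"
    and tri: "triangulated (AG_verts R) (AG_adj R)"
  shows "zero_ideal_anti_fixed_place R"
proof (rule ccontr)
  assume "\<not> zero_ideal_anti_fixed_place R"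
  then obtain P x where P: "primeideal P R" "x \<in> carrier R" "P = Ann R {x}"
    by (auto simp: zero_ideal_anti_fixed_place_def bourbaki_primes_def)
  have iP: "ideal P R" using P(1) by (rule primeideal.axioms(1))
  have "x \<noteq> \<zero>"
    using P primeideal.I_notcarr[OF P(1)] by (auto simp: Ann_def)
  moreover have "p \<otimes> x = \<zero>" if "p \<in> P" for p
    using that P(2,3) m_comm[of p x] by (simp add: Ann_def)
  moreover have "P \<noteq> {\<zero>}"
    using P(1) nd primeideal_zero_imp_domain by blast
  ultimately have "P \<in> AG_verts R"
    using AG_vertsI[OF iP _ P(2)] by blast
  then obtain J K where JK: "J \<in> AG_verts R" "K \<in> AG_verts R"
      "AG_adj R P J" "AG_adj R P K" "AG_adj R J K"
    using tri unfolding triangulated_def by blast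
  then have id: "ideal J R" "ideal K R" "J \<noteq> {\<zero>}" "K \<noteq> {\<zero>}"
    by (auto simp: AG_verts_def)
  have prods: "\<forall>i\<in>P. \<forall>j\<in>J. i \<otimes> j = \<zero>" "\<forall>i\<in>P. \<forall>j\<in>K. i \<otimes> j = \<zero>" "\<forall>i\<in>J. \<forall>j\<in>K. i \<otimes> j = \<zero>"
    using JK(3-5) iP id unfolding AG_adj_def by (auto simp: ideal_prod_eq_zero_iff)
  have "\<zero> \<in> P"
    using iP by (simp add: additive_subgroup.zero_closed ideal.axioms(1))
  then have "J \<subseteq> P \<or> K \<subseteq> P"
    using primeideal_subset_or[OF P(1) id(1,2)] prods(3) by simp
  then show False
    using reduced_ideal_square_zero[OF red] id prods(1,2) by (metis subsetD)
qed

section \<open>Minimal primes avoiding a nonzero element\<close>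

text \<open>A maximal multiplicative set avoiding \<open>\<zero>\<close> is the complement of a minimal prime, so a single
  application of Zorn's lemma suffices.\<close>

lemma reduced_ex_min_prime_avoiding:
  assumes red: "reduced_ring R" and z: "z \<in> carrier R" "z \<noteq> \<zero>"
  obtains P where "P \<in> min_primes R" "z \<notin> P"
proof -
  \<comment> \<open>Demanding \<open>z\<close> in every member makes the complement of a maximal
    member avoid \<open>z\<close>. Reducedness puts the set of powers of \<open>z\<close> into
    \<open>F\<close>.\<close>
  define F where "F = {S. S \<subseteq> carrier R \<and> \<one> \<in> S \<and> z \<in> S \<and> \<zero> \<notin> S \<and> (\<forall>a\<in>S. \<forall>b\<in>S. a \<otimes> b \<in> S)}"
  have "\<exists>M\<in>F. \<forall>X\<in>F. M \<subseteq> X \<longrightarrow> X = M"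
  proof (rule subset_Zorn_nonempty)
    have "range (\<lambda>n::nat. z [^] n) \<in> F"
    proof -
      have "\<one> = z [^] (0::nat)" "z = z [^] (1::nat)" using z by auto
      then have "\<one> \<in> range (\<lambda>n::nat. z [^] n)" "z \<in> range (\<lambda>n::nat. z [^] n)"
        by blast+
      moreover have "\<zero> \<notin> range (\<lambda>n::nat. z [^] n)"
        using red z unfolding reduced_ring_def by (metis imageE)
      moreover have "range (\<lambda>n::nat. z [^] n) \<subseteq> carrier R"
        using z by auto
      moreover have "z [^] m \<otimes> z [^] n \<in> range (\<lambda>n::nat. z [^] n)" for m n :: nat
        using nat_pow_mult[OF z(1)] by auto
      ultimately show ?thesis by (auto simp: F_def)
    qed
    then show "F \<noteq> {}" by blast
  next
    fix C assume C: "C \<noteq> {}" "subset.chain F C"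
    then have CF: "C \<subseteq> F" by (auto simp: subset_chain_def)
    have "a \<otimes> b \<in> \<Union>C" if ab: "a \<in> \<Union>C" "b \<in> \<Union>C" for a b
    proof -
      obtain S T where ST: "S \<in> C" "a \<in> S" "T \<in> C" "b \<in> T" using ab by blast
      then have "S \<subseteq> T \<or> T \<subseteq> S" using C(2) by (auto simp: subset_chain_def)
      then obtain U where "U \<in> C" "a \<in> U" "b \<in> U" using ST by blast
      then show ?thesis using CF by (auto simp: F_def)
    qed
    then show "\<Union>C \<in> F" using C(1) CF unfolding F_def by blast
  qed
  then obtain S where S: "S \<in> F" and max: "\<And>X. X \<in> F \<Longrightarrow> S \<subseteq> X \<Longrightarrow> X = S" by blast
  have Sc: "S \<subseteq> carrier R" "\<one> \<in> S" "z \<in> S" "\<zero> \<notin> S"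
    and Sm: "\<And>a b. a \<in> S \<Longrightarrow> b \<in> S \<Longrightarrow> a \<otimes> b \<in> S"
    using S by (auto simp: F_def)
  define P where "P = carrier R - S"
  \<comment> \<open>This is where maximality enters: if no element of \<open>S\<close> kills
    \<open>a\<close>, then adjoining the powers of \<open>a\<close> to \<open>S\<close> gives a
    larger member of \<open>F\<close>.\<close>
  have ex: "\<exists>s\<in>S. s \<otimes> a = \<zero>" if a: "a \<in> P" for a
  proof (rule ccontr)
    assume no: "\<not> ?thesis"
    have ac: "a \<in> carrier R" "a \<notin> S" using a by (auto simp: P_def)
    define X where "X = {s \<otimes> a [^] n |s (n::nat). s \<in> S}"
    have "\<zero> \<notin> X"
    proof
      assume "\<zero> \<in> X"
      then obtain s and n :: nat where s: "s \<in> S" "s \<otimes> a [^] n = \<zero>" by (auto simp: X_def)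
      then have sc: "s \<in> carrier R" using Sc by blast
      \<comment> \<open>The exponent \<open>Suc n\<close> leaves a factor \<open>s\<close> to split
        off s a^n even when \<open>n\<close> is 0; thus s a is nilpotent, hence zero.\<close>
      have "(s \<otimes> a) [^] Suc n = (s [^] n \<otimes> a) \<otimes> (s \<otimes> a [^] n)"
        using sc ac(1) by (simp add: nat_pow_distrib m_ac)
      also have "\<dots> = \<zero>" using s sc ac(1) by simp
      finally have "s \<otimes> a = \<zero>"
        using red sc ac(1) unfolding reduced_ring_def by blast
      with no s show False by blast
    qed
    have SX: "S \<subseteq> X"
    proof
      fix s assume s: "s \<in> S"
      then have "s = s \<otimes> a [^] (0::nat)" using Sc by auto
      with s show "s \<in> X" unfolding X_def by blast
    qed
    have "X \<subseteq> carrier R" using Sc ac by (auto simp: X_def)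
    moreover have "u \<otimes> v \<in> X" if "u \<in> X" "v \<in> X" for u v
    proof -
      obtain s t and m n :: nat where *: "s \<in> S" "t \<in> S" "u = s \<otimes> a [^] m" "v = t \<otimes> a [^] n"
        using \<open>u \<in> X\<close> \<open>v \<in> X\<close> by (auto simp: X_def)
      then have "s \<in> carrier R" "t \<in> carrier R" using Sc by auto
      then have "u \<otimes> v = (s \<otimes> t) \<otimes> (a [^] m \<otimes> a [^] n)"
        using * ac(1) by (simp add: m_ac)
      then have "u \<otimes> v = (s \<otimes> t) \<otimes> a [^] (m + n)"
        using ac(1) by (simp add: nat_pow_mult)
      then show ?thesis using Sm *(1,2) unfolding X_def by blast
    qed
    ultimately have "X \<in> F" using \<open>\<zero> \<notin> X\<close> SX Sc by (auto simp: F_def)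
    then have "X = S" using max SX by blast
    moreover have "a \<in> X"
    proof -
      have "a = \<one> \<otimes> a [^] (1::nat)" using ac(1) by simp
      then show ?thesis using Sc(2) unfolding X_def by blast
    qed
    ultimately show False using ac by blast
  qed
  \<comment> \<open>So \<open>P\<close> is the kernel of the localization map at \<open>S\<close>.
    Conversely, an element of \<open>S\<close> killed by \<open>S\<close> would put zero into
    \<open>S\<close>. With this description the ideal axioms follow by multiplying the witnesses
    from \<open>S\<close>.\<close>
  have mem_iff: "a \<in> P \<longleftrightarrow> a \<in> carrier R \<and> (\<exists>s\<in>S. s \<otimes> a = \<zero>)" for a
    using ex Sm Sc(4) unfolding P_def by (metis DiffD1 DiffI)
  have "ideal P R"
  proof (rule idealI)
    show "ring R" by (rule ring_axioms)
    show "subgroup P (add_monoid R)"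
    proof (rule add.subgroupI)
      show "P \<subseteq> carrier R" by (auto simp: P_def)
      show "P \<noteq> {}" using Sc(4) by (auto simp: P_def)
    next
      fix a assume "a \<in> P"
      then obtain s where s: "s \<in> S" "s \<otimes> a = \<zero>" "a \<in> carrier R" using mem_iff by blast
      then have "s \<otimes> (\<ominus> a) = \<zero>" using Sc(1) by (simp add: r_minus subsetD)
      with s show "\<ominus> a \<in> P" using mem_iff by blast
    next
      fix a b assume "a \<in> P" "b \<in> P"
      then obtain s t where st: "s \<in> S" "s \<otimes> a = \<zero>" "a \<in> carrier R"
          "t \<in> S" "t \<otimes> b = \<zero>" "b \<in> carrier R"
        using mem_iff by blast
      then have c: "s \<in> carrier R" "t \<in> carrier R" using Sc by auto
      have "(s \<otimes> t) \<otimes> (a \<oplus> b) = t \<otimes> (s \<otimes> a) \<oplus> s \<otimes> (t \<otimes> b)"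
        using c st(3,6) by (simp add: r_distr m_ac)
      then have "(s \<otimes> t) \<otimes> (a \<oplus> b) = \<zero>" using st c by simp
      then show "a \<oplus> b \<in> P" using mem_iff Sm st by blast
    qed
  next
    fix a r assume "a \<in> P" and r: "r \<in> carrier R"
    then obtain s where s: "s \<in> S" "s \<otimes> a = \<zero>" "a \<in> carrier R" using mem_iff by blast
    then have "s \<in> carrier R" using Sc by blast
    then have "s \<otimes> (a \<otimes> r) = \<zero>" using s r by (simp flip: m_assoc)
    then show "a \<otimes> r \<in> P" using mem_iff s r by blast
    then show "r \<otimes> a \<in> P" using s r by (simp add: m_comm)
  qed
  then have prime: "primeideal P R"
    by (rule primeidealI) (use Sc Sm is_cring in \<open>auto simp: P_def\<close>)
  \<comment> \<open>For \<open>a\<close> in \<open>P\<close>, the element \<open>s\<close> of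
    \<open>S\<close> killing \<open>a\<close> lies outside \<open>P\<close>, hence outside
    \<open>Q\<close>; primality of \<open>Q\<close> then gives \<open>a\<close> in
    \<open>Q\<close>.\<close>
  have "Q = P" if Q: "primeideal Q R" "Q \<subseteq> P" for Q
  proof
    show "P \<subseteq> Q"
    proof
      fix a assume "a \<in> P"
      then obtain s where s: "s \<in> S" "s \<otimes> a = \<zero>" "a \<in> carrier R" using mem_iff by blast
      have "\<zero> \<in> Q"
        by (rule additive_subgroup.zero_closed[OF ideal.axioms(1)[OF primeideal.axioms(1)[OF Q(1)]]])
      then have "s \<in> Q \<or> a \<in> Q"
        using primeideal.I_prime[OF Q(1), of s a] s Sc(1) by auto
      then show "a \<in> Q" using s Q(2) by (auto simp: P_def)
    qed
  qed (rule Q(2))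
  with prime have "P \<in> min_primes R" by (auto simp: min_primes_def)
  moreover have "z \<notin> P" using Sc by (simp add: P_def)
  ultimately show thesis by (rule that)
qed

section \<open>Isolated points of the minimal spectrum\<close>

lemma primeideal_Ann_subset:
  assumes "primeideal Q R" "x \<in> carrier R" "x \<notin> Q"
  shows "Ann R {x} \<subseteq> Q"
proof
  fix p assume p: "p \<in> Ann R {x}"
  have "\<zero> \<in> Q"
    by (rule additive_subgroup.zero_closed[OF ideal.axioms(1)[OF primeideal.axioms(1)[OF assms(1)]]])
  then show "p \<in> Q"
    using p primeideal.I_prime[OF assms(1,2), of p] assms(3) by (auto simp: Ann_def)
qed

text \<open>The sets of minimal primes avoiding a single element form a base of the topology, and an
  open singleton must itself be a basic set.\<close>

lemma isolated_point_min_spec_iff: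
  "isolated_point (min_spec R) P \<longleftrightarrow>
     (\<exists>x\<in>carrier R. {Q \<in> min_primes R. x \<notin> Q} = {P})"
proof
  assume "isolated_point (min_spec R) P"
  then obtain I where I: "ideal I R" "{P} = min_primes R - {Q \<in> min_primes R. I \<subseteq> Q}"
    by (auto simp: isolated_point_def openin_min_spec)
  have P: "P \<in> min_primes R" "\<not> I \<subseteq> P" using I(2) by auto
  then obtain x where x: "x \<in> I" "x \<notin> P" by blast
  have "{Q \<in> min_primes R. x \<notin> Q} = {P}"
    using I(2) P x by auto
  with x ideal.Icarr[OF I(1)] show "\<exists>x\<in>carrier R. {Q \<in> min_primes R. x \<notin> Q} = {P}"
    by blast
next
  assume "\<exists>x\<in>carrier R. {Q \<in> min_primes R. x \<notin> Q} = {P}"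
  then obtain x where x: "x \<in> carrier R" "{Q \<in> min_primes R. x \<notin> Q} = {P}" by blast
  have "PIdl x \<subseteq> Q \<longleftrightarrow> x \<in> Q" if "Q \<in> min_primes R" for Q
    using that cgenideal_minimal[of Q x] cgenideal_self[OF x(1)] primeideal.axioms(1)
    by (auto simp: min_primes_def)
  then have "{P} = min_primes R - {Q \<in> min_primes R. PIdl x \<subseteq> Q}"
    using x(2) by auto
  with cgenideal_ideal[OF x(1)] have "openin (min_spec R) {P}"
    unfolding openin_min_spec by blast
  moreover have "P \<in> min_primes R" using x(2) by blast
  ultimately show "isolated_point (min_spec R) P"
    by (simp add: isolated_point_def topspace_min_spec)
qed

text \<open>Otherwise \<open>x\<close> squares to zero, so it is zero and its annihilator is the
  whole ring, which is not prime.\<close>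

lemma reduced_Ann_self_notin:
  assumes "reduced_ring R" "x \<in> carrier R" "primeideal (Ann R {x}) R"
  shows "x \<notin> Ann R {x}"
proof
  assume "x \<in> Ann R {x}"
  then have "x = \<zero>"
    using reduced_square_zero[OF assms(1,2)] by (simp add: Ann_def)
  then have "Ann R {x} = carrier R" by (auto simp: Ann_def)
  then show False using primeideal.I_notcarr[OF assms(3)] by simp
qed

lemma reduced_isolated_point_iff_bourbaki:
  assumes red: "reduced_ring R"
  shows "isolated_point (min_spec R) P \<longleftrightarrow> P \<in> bourbaki_primes R"
proof
  assume "P \<in> bourbaki_primes R"
  then obtain x where P: "primeideal P R" "x \<in> carrier R" "P = Ann R {x}"
    by (auto simp: bourbaki_primes_def)
  have xP: "x \<notin> P" using reduced_Ann_self_notin[OF red P(2)] P by simp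
  \<comment> \<open>A prime inside \<open>P\<close> also avoids \<open>x\<close>, so it contains
    \<open>Ann R {x}\<close>, which is \<open>P\<close>. The same inclusion, with minimality of
    \<open>Q\<close>, gives uniqueness below.\<close>
  have "P \<in> min_primes R"
    using P primeideal_Ann_subset[OF _ P(2)] xP by (fastforce simp: min_primes_def)
  moreover have "Q = P" if "Q \<in> min_primes R" "x \<notin> Q" for Q
    using that P primeideal_Ann_subset[OF _ P(2), of Q] by (auto simp: min_primes_def)
  ultimately have "{Q \<in> min_primes R. x \<notin> Q} = {P}" using xP by blast
  with P(2) show "isolated_point (min_spec R) P"
    unfolding isolated_point_min_spec_iff by blast
next
  assume "isolated_point (min_spec R) P"
  then obtain x where x: "x \<in> carrier R" "{Q \<in> min_primes R. x \<notin> Q} = {P}"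
    unfolding isolated_point_min_spec_iff by blast
  then have P: "primeideal P R" "x \<notin> P" by (auto simp: min_primes_def)
  have "P \<subseteq> Ann R {x}"
  proof
    fix p assume p: "p \<in> P"
    have iP: "ideal P R" using P(1) by (rule primeideal.axioms(1))
    have pc: "p \<in> carrier R" using ideal.Icarr[OF iP p] .
    have "x \<otimes> p = \<zero>"
    proof (rule ccontr)
      assume "x \<otimes> p \<noteq> \<zero>"
      \<comment> \<open>A minimal prime avoiding x p avoids both factors. Avoiding \<open>x\<close>
        makes it equal to \<open>P\<close>, which contains \<open>p\<close>.\<close>
      then obtain Q where Q: "Q \<in> min_primes R" "x \<otimes> p \<notin> Q"
        using reduced_ex_min_prime_avoiding[OF red] x(1) pc by blast
      then have iQ: "ideal Q R" by (simp add: min_primes_def primeideal.axioms(1))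
      then have "x \<notin> Q" using Q(2) ideal.I_r_closed[OF iQ _ pc] by blast
      then have "Q = P" using Q(1) x(2) by blast
      then show False using Q(2) ideal.I_l_closed[OF iP p x(1)] by blast
    qed
    with pc show "p \<in> Ann R {x}" by (simp add: Ann_def)
  qed
  then have "P = Ann R {x}" using primeideal_Ann_subset[OF P(1) x(1) P(2)] by blast
  with P(1) x(1) show "P \<in> bourbaki_primes R" by (auto simp: bourbaki_primes_def)
qed

end

theorem theorem3p6:
  fixes R :: "('a, 'b) ring_scheme"
  assumes "cring R" and "reduced_ring R"
  shows "(zero_ideal_anti_fixed_place R \<longleftrightarrow> \<not> (\<exists>P. isolated_point (min_spec R) P)) \<and>
         (\<not> domain R \<longrightarrow>
           (zero_ideal_anti_fixed_place R \<longleftrightarrow> triangulated (AG_verts R) (AG_adj R)))"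
proof -
  interpret cring R by (rule assms(1))
  show ?thesis
    using reduced_isolated_point_iff_bourbaki[OF assms(2)]
      triangulated_if_anti_fixed_place[OF assms(2)] anti_fixed_place_if_triangulated[OF assms(2)]
    by (auto simp: zero_ideal_anti_fixed_place_def)
qed

end
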